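(* If $\mathfrak A$ is a uniformly weakly Radon-Nikod\'ym (UWRN) Boolean algebra, then its Stone space $\operatorname{ult}(\mathfrak A)$ is sequentially compact.
   Context: A family $\{a_i:i\in I\}$ in a Boolean algebra is independent if $\bigcap_{i\in I'}a_i\cap\bigcap_{i\in I''}a_i^c\neq 0$ for all finite disjoint $I',I''\subseteq I$. A Boolean algebra $\mathfrak A$ is UWRN if it is generated by a family $\mathcal G=\bigcup_{n\ge 1}\mathcal G_n$ such that, for every $n\ge 1$, $\mathcal G_n$ contains no independent sequence of length $n$. $\operatorname{ult}(\mathfrak A)$ is the Stone space of ultrafilters on $\mathfrak A$. *)

theory Defs
  imports "HOL-Analysis.Analysis"
begin

(* Class boolean_algebra does not exclude the one-element algebra (bot = top); its Stone space is
   empty. *)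

inductive_set generated_subalgebra :: "'a::boolean_algebra set \<Rightarrow> 'a set" for G where
  generator: "a \<in> G \<Longrightarrow> a \<in> generated_subalgebra G"
| bot: "bot \<in> generated_subalgebra G"
| top: "top \<in> generated_subalgebra G"
| sup: "a \<in> generated_subalgebra G \<Longrightarrow> b \<in> generated_subalgebra G \<Longrightarrow>
    sup a b \<in> generated_subalgebra G"
| inf: "a \<in> generated_subalgebra G \<Longrightarrow> b \<in> generated_subalgebra G \<Longrightarrow>
    inf a b \<in> generated_subalgebra G"
| compl: "a \<in> generated_subalgebra G \<Longrightarrow> - a \<in> generated_subalgebra G"

(* Inf_fin is only meaningful on nonempty finite sets; inserting top makes the empty meet top. *)
definition finite_meet :: "'i set \<Rightarrow> ('i \<Rightarrow> 'a::boolean_algebra) \<Rightarrow> 'a" where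
  "finite_meet J a = Inf_fin (insert top (a ` J))"

definition independent_family :: "'i set \<Rightarrow> ('i \<Rightarrow> 'a::boolean_algebra) \<Rightarrow> bool" where
  "independent_family I a \<longleftrightarrow>
    (\<forall>J K. finite J \<and> finite K \<and> J \<subseteq> I \<and> K \<subseteq> I \<and> J \<inter> K = {} \<longrightarrow>
      inf (finite_meet J a) (finite_meet K (\<lambda>i. - a i)) \<noteq> bot)"

(* A Boolean algebra is given by its type, so the argument of UWRN only names that type. *)
definition UWRN :: "'a::boolean_algebra itself \<Rightarrow> bool" where
  "UWRN (_ :: 'a itself) \<longleftrightarrow>
    (\<exists>G :: nat \<Rightarrow> 'a set.
      generated_subalgebra (\<Union>n\<in>{1..}. G n) = UNIV \<and>
      (\<forall>n\<ge>1. \<not> (\<exists>a :: nat \<Rightarrow> 'a. a ` {1..n} \<subseteq> G n \<and> independent_family {1..n} a)))"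

definition proper_filter :: "'a::boolean_algebra set \<Rightarrow> bool" where
  "proper_filter F \<longleftrightarrow>
    top \<in> F \<and> bot \<notin> F \<and>
    (\<forall>a\<in>F. \<forall>b\<in>F. inf a b \<in> F) \<and>
    (\<forall>a\<in>F. \<forall>b. a \<le> b \<longrightarrow> b \<in> F)"

definition ultrafilter :: "'a::boolean_algebra set \<Rightarrow> bool" where
  "ultrafilter F \<longleftrightarrow> proper_filter F \<and> (\<forall>F'. proper_filter F' \<and> F \<subseteq> F' \<longrightarrow> F' = F)"

definition ult_basic :: "'a::boolean_algebra \<Rightarrow> 'a set set" where
  "ult_basic a = {F. ultrafilter F \<and> a \<in> F}"

(* The sets ult_basic a form a base, and ult_basic top is the set of all ultrafilters, which is
   therefore the carrier. *)
definition stone_space :: "'a::boolean_algebra itself \<Rightarrow> 'a set topology" where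
  "stone_space (_ :: 'a itself) = topology_generated_by (range (ult_basic :: 'a \<Rightarrow> 'a set set))"

lemma topspace_stone_space:
  "topspace (stone_space TYPE('a::boolean_algebra)) = {F :: 'a set. ultrafilter F}"
  by (auto simp: stone_space_def ult_basic_def ultrafilter_def proper_filter_def)

(* The counterpart of seq_compact for an abstract topology. *)
definition seq_compact_space :: "'b topology \<Rightarrow> bool" where
  "seq_compact_space X \<longleftrightarrow>
    (\<forall>x :: nat \<Rightarrow> 'b. (\<forall>n. x n \<in> topspace X) \<longrightarrow>
      (\<exists>l\<in>topspace X. \<exists>r :: nat \<Rightarrow> nat. strict_mono r \<and> limitin X (x \<circ> r) l sequentially))"

end

theory Submission
  imports Defs "HOL-Library.Ramsey" "HOL-Library.Diagonal_Subsequence"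
begin

text \<open>
  A sequence of ultrafilters converges in the Stone space as soon as each element of a generating
  set lies in almost all or in almost none of its terms: the elements with this property form a
  subalgebra (\<open>eventually_decides_generated\<close>), and once this is the whole algebra, the elements that
  lie in almost all terms form the limit (\<open>convergent_if_eventually_decides\<close>). Membership in almost
  all or almost no terms survives passing to a subsequence and depends only on a tail, so by a
  diagonal argument it is enough to treat the pieces of the generating family one at a time.

  Consider one piece \<open>G\<close>, without independent \<open>n\<close>-tuples. Each \<open>a \<in> G\<close> selects the set of indices
  \<open>k\<close> with \<open>a \<in> x k\<close>. If these index sets cut out every subset of some \<open>2\<^sup>n\<close> indices, then \<open>G\<close> has
  an independent \<open>n\<close>-tuple: label the \<open>2\<^sup>n\<close> ultrafilters by the subsets of \<open>{1..n}\<close> and choose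
  \<open>a\<^sub>i \<in> G\<close> that lies in exactly those ultrafilters whose label contains \<open>i\<close>; every Boolean
  combination of the \<open>a\<^sub>i\<close> then belongs to one of the ultrafilters
  (\<open>independent_family_if_shattered\<close>). This is the usual passage between the Vapnik-Chervonenkis
  dimension of a set system and that of its dual.

  It remains to see that a system of sets of natural numbers that shatters no \<open>r\<close>-element set admits
  an infinite set of indices split by none of its members
  (\<open>infinite_set_splitting_no_member\<close>). This is an application of Ramsey's theorem, in the manner of
  extracting indiscernibles: on an infinite set where all \<open>r\<close>-subsets have the same traces, a single
  member that splits it realises each pattern on a suitable \<open>r\<close>-subset, and hence all patterns occur on
  all \<open>r\<close>-subsets.
\<close>

section \<open>Sequences avoiding shattered tuples\<close>

lemma strict_mono_with_prescribed_membership: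
  fixes M A S :: "nat set"
  assumes "infinite (M \<inter> A)" and "infinite (M - A)"
  obtains k :: "nat \<Rightarrow> nat"
  where "strict_mono k" and "\<And>j. k j \<in> M" and "\<And>j. k j \<in> A \<longleftrightarrow> j \<in> S"
proof -
  have next_element: "\<exists>m>b. m \<in> M \<and> (m \<in> A \<longleftrightarrow> j \<in> S)" for b j
    using assms unfolding infinite_nat_iff_unbounded by (cases "j \<in> S") auto
  have "\<exists>k. \<forall>j. (k j \<in> M \<and> (k j \<in> A \<longleftrightarrow> j \<in> S)) \<and> k j < k (Suc j)"
  proof (rule dependent_nat_choice)
    show "\<exists>m. m \<in> M \<and> (m \<in> A \<longleftrightarrow> 0 \<in> S)"
      using next_element by blast
  next
    fix m j
    show "\<exists>m'. (m' \<in> M \<and> (m' \<in> A \<longleftrightarrow> Suc j \<in> S)) \<and> m < m'"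
      using next_element by blast
  qed
  then show thesis
    using that by (metis strict_mono_Suc_iff)
qed

lemma nth_sorted_list_of_strict_mono_image:
  fixes k :: "nat \<Rightarrow> nat"
  assumes "strict_mono k" and "j < r"
  shows "sorted_list_of_set (k ` {..<r}) ! j = k j"
proof -
  have inj: "inj_on k {..<r}"
    using assms(1) by (simp add: strict_mono_on_imp_inj_on strict_mono_on_def strict_mono_def)
  have "sorted_list_of_set (k ` {..<r}) = map k [0..<r]"
  proof (rule sorted_distinct_set_unique)
    show "sorted (map k [0..<r])"
      using assms(1) by (auto simp: sorted_iff_nth_mono strict_mono_less_eq)
    show "distinct (map k [0..<r])"
      using inj by (simp add: distinct_map atLeast0LessThan)
  qed (auto simp: atLeast0LessThan)
  with assms(2) show ?thesis by simp
qed

text \<open>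
  Ramsey's theorem is applied to the colouring of an \<open>r\<close>-set by its full collection of traces. Colouring
  only by whether the set is shattered would not suffice: a member that splits the homogeneous set
  realises different patterns on different \<open>r\<close>-sets, and it is homogeneity of the traces that
  transfers all of them to one and the same \<open>r\<close>-set.
\<close>
lemma infinite_set_splitting_no_member:
  fixes C :: "nat set set" and r :: nat
  assumes not_shattered: "\<And>k :: nat \<Rightarrow> nat. strict_mono k \<Longrightarrow>
    \<exists>S\<subseteq>{..<r}. \<forall>A\<in>C. \<exists>j<r. \<not> (k j \<in> A \<longleftrightarrow> j \<in> S)"
  obtains M :: "nat set"
  where "infinite M" and "\<And>A. A \<in> C \<Longrightarrow> finite (M \<inter> A) \<or> finite (M - A)"
proof -
  \<comment> \<open>Listing an \<open>r\<close>-set in increasing order identifies it with \<open>{..<r}\<close>, so that the traces of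
      different sets can be compared.\<close>
  define traces :: "nat set \<Rightarrow> nat set set" where
    "traces X = {S. S \<subseteq> {..<r} \<and> (\<exists>A\<in>C. \<forall>j<r. sorted_list_of_set X ! j \<in> A \<longleftrightarrow> j \<in> S)}" for X
  have traces_image: "S \<in> traces (k ` {..<r}) \<longleftrightarrow>
      S \<subseteq> {..<r} \<and> (\<exists>A\<in>C. \<forall>j<r. k j \<in> A \<longleftrightarrow> j \<in> S)" if "strict_mono k" for k S
    using nth_sorted_list_of_strict_mono_image[OF that] by (auto simp: traces_def)
  have "finite (Pow (Pow {..<r}))" by simp
  from finite_imp_inj_to_nat_seg[OF this] obtain code :: "nat set set \<Rightarrow> nat" and s
    where code: "code ` Pow (Pow {..<r}) = {i. i < s}" "inj_on code (Pow (Pow {..<r}))"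
    by (elim exE conjE)
  have traces_Pow: "traces X \<in> Pow (Pow {..<r})" for X by (auto simp: traces_def)
  have code_less: "code (traces X) < s" for X
    using code(1) imageI[OF traces_Pow, of code X] by blast
  have "\<exists>Y t. Y \<subseteq> UNIV \<and> infinite Y \<and> t < s \<and>
      (\<forall>X. X \<subseteq> Y \<and> finite X \<and> card X = r \<longrightarrow> code (traces X) = t)"
    by (rule Ramsey) (simp_all add: code_less)
  then obtain M t where "infinite M"
    and code_const: "\<forall>X. X \<subseteq> M \<and> finite X \<and> card X = r \<longrightarrow> code (traces X) = t"
    by (elim exE conjE)
  have card_image_k: "card (k ` {..<r}) = r" if "strict_mono k" for k :: "nat \<Rightarrow> nat"
    using that by (simp add: card_image strict_mono_imp_inj_on inj_on_subset)
  have traces_const: "traces (k ` {..<r}) = traces (k' ` {..<r})"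
    if "strict_mono k" "\<And>j. k j \<in> M" "strict_mono k'" "\<And>j. k' j \<in> M" for k k'
  proof (rule inj_onD[OF code(2) _ traces_Pow traces_Pow])
    show "code (traces (k ` {..<r})) = code (traces (k' ` {..<r}))"
      using that code_const
      by (simp add: card_image_k image_subset_iff)
  qed
  have "finite (M \<inter> A) \<or> finite (M - A)" if "A \<in> C" for A
  proof (rule ccontr)
    assume "\<not> ?thesis"
    then have split: "infinite (M \<inter> A)" "infinite (M - A)" by auto
    define e where "e = enumerate M"
    have e: "strict_mono e" "\<And>j. e j \<in> M"
      using \<open>infinite M\<close> by (auto simp: e_def strict_mono_enumerate enumerate_in_set)
    from not_shattered[OF e(1)] obtain S where "S \<subseteq> {..<r}"
      and missing: "\<forall>A\<in>C. \<exists>j<r. \<not> (e j \<in> A \<longleftrightarrow> j \<in> S)" by blast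
    obtain k where k: "strict_mono k" "\<And>j. k j \<in> M" and "\<And>j. k j \<in> A \<longleftrightarrow> j \<in> S"
      using strict_mono_with_prescribed_membership[OF split] by blast
    then have "S \<in> traces (k ` {..<r})"
      using \<open>A \<in> C\<close> \<open>S \<subseteq> {..<r}\<close> by (auto simp: traces_image[OF k(1)])
    then have "S \<in> traces (e ` {..<r})"
      using traces_const[OF k e] by simp
    with missing show False
      by (auto simp: traces_image[OF e(1)])
  qed
  with \<open>infinite M\<close> show thesis by (rule that)
qed

section \<open>Ultrafilters\<close>

lemma proper_filter_not_both:
  assumes "proper_filter F" and "a \<in> F"
  shows "- a \<notin> F"
  using assms unfolding proper_filter_def by (metis inf_compl_bot)

lemma proper_filter_inf_iff:
  assumes "proper_filter F"
  shows "inf a b \<in> F \<longleftrightarrow> a \<in> F \<and> b \<in> F"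
  using assms unfolding proper_filter_def by (meson inf.cobounded1 inf.cobounded2)

text \<open>
  If a maximal proper filter \<open>F\<close> contains neither \<open>a\<close> nor \<open>- a\<close>, then no \<open>b \<in> F\<close> is disjoint from
  \<open>a\<close>, so \<open>F\<close> and \<open>a\<close> generate a strictly larger proper filter.
\<close>
lemma ultrafilter_iff_prime:
  "ultrafilter F \<longleftrightarrow> proper_filter F \<and> (\<forall>a. a \<in> F \<or> - a \<in> F)"
proof
  assume F: "ultrafilter F"
  then have pf: "proper_filter F" by (simp add: ultrafilter_def)
  have "a \<in> F" if "- a \<notin> F" for a
  proof -
    define F' where "F' = {c. \<exists>b\<in>F. inf a b \<le> c}"
    have "proper_filter F'"
      unfolding proper_filter_def
    proof (intro conjI ballI allI impI)
      show "top \<in> F'" using pf by (auto simp: F'_def proper_filter_def)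
      show "bot \<notin> F'"
      proof
        assume "bot \<in> F'"
        then obtain b where "b \<in> F" "inf b a = bot"
          by (auto simp: F'_def le_bot inf_commute)
        then have "b \<le> - a" by (simp add: inf_shunt)
        with \<open>b \<in> F\<close> \<open>- a \<notin> F\<close> pf show False by (auto simp: proper_filter_def)
      qed
      show "inf c d \<in> F'" if cd: "c \<in> F'" "d \<in> F'" for c d
      proof -
        from cd obtain b b' where b: "b \<in> F" "inf a b \<le> c" "b' \<in> F" "inf a b' \<le> d"
          by (auto simp: F'_def)
        then have "inf a (inf b b') \<le> inf c d"
          by (meson inf.bounded_iff inf.cobounded1 inf.cobounded2 order_trans)
        moreover have "inf b b' \<in> F" using pf b by (simp add: proper_filter_def)
        ultimately show ?thesis by (auto simp: F'_def)
      qed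
      show "d \<in> F'" if "c \<in> F'" "c \<le> d" for c d
        using that by (auto simp: F'_def intro: order_trans)
    qed
    moreover have "F \<subseteq> F'" by (auto simp: F'_def intro: inf.cobounded2)
    ultimately have "F' = F" using F by (simp add: ultrafilter_def)
    moreover have "a \<in> F'" using pf by (auto simp: F'_def proper_filter_def)
    ultimately show ?thesis by simp
  qed
  with pf show "proper_filter F \<and> (\<forall>a. a \<in> F \<or> - a \<in> F)" by blast
next
  assume F: "proper_filter F \<and> (\<forall>a. a \<in> F \<or> - a \<in> F)"
  then show "ultrafilter F"
    unfolding ultrafilter_def using proper_filter_not_both by blast
qed

lemma ultrafilter_compl_iff:
  assumes "ultrafilter F"
  shows "- a \<in> F \<longleftrightarrow> a \<notin> F"
  using assms proper_filter_not_both by (auto simp: ultrafilter_iff_prime)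

lemma finite_meet_in_proper_filter_iff:
  assumes "proper_filter F" and "finite J"
  shows "finite_meet J a \<in> F \<longleftrightarrow> (\<forall>i\<in>J. a i \<in> F)"
  using assms(2)
proof induction
  case empty
  then show ?case using assms(1) by (simp add: finite_meet_def proper_filter_def)
next
  case (insert i J)
  have "finite_meet (insert i J) a = inf (a i) (finite_meet J a)"
    using insert.hyps
    by (simp add: finite_meet_def insert_commute[of top] Inf_fin.insert)
  then show ?case
    using insert.IH by (simp add: proper_filter_inf_iff[OF assms(1)])
qed

section \<open>Shattered ultrafilters yield independent elements\<close>

text \<open>
  The bijection \<open>h\<close> below labels the ultrafilters by the subsets of \<open>I\<close>. For disjoint \<open>J\<close> and \<open>K\<close>
  the ultrafilter labelled \<open>J\<close> contains \<open>a i\<close> for \<open>i \<in> J\<close> and \<open>- a i\<close> for \<open>i \<in> K\<close>, hence also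
  their meet, which is therefore not \<open>bot\<close>.
\<close>
lemma independent_family_if_shattered:
  fixes G :: "'a::boolean_algebra set" and y :: "nat \<Rightarrow> 'a set"
  assumes "finite I"
    and "\<And>j. j < 2 ^ card I \<Longrightarrow> ultrafilter (y j)"
    and shattered: "\<And>S. S \<subseteq> {..<2 ^ card I} \<Longrightarrow> \<exists>a\<in>G. \<forall>j<2 ^ card I. a \<in> y j \<longleftrightarrow> j \<in> S"
  obtains a :: "'i \<Rightarrow> 'a" where "a ` I \<subseteq> G" and "independent_family I a"
proof -
  have "card (Pow I) = 2 ^ card I" using assms(1) by (rule card_Pow)
  then obtain h where "bij_betw h {0..<2 ^ card I :: nat} (Pow I)"
    using ex_bij_betw_nat_finite[of "Pow I"] assms(1) by auto
  then have h: "h ` {..<2 ^ card I} = Pow I"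
    by (simp add: bij_betw_def atLeast0LessThan)
  have "\<exists>a\<in>G. \<forall>j<2 ^ card I. a \<in> y j \<longleftrightarrow> i \<in> h j" for i
    using shattered[of "{j. j < 2 ^ card I \<and> i \<in> h j}"] by auto
  then obtain a where a: "\<And>i. a i \<in> G" "\<And>i j. j < 2 ^ card I \<Longrightarrow> a i \<in> y j \<longleftrightarrow> i \<in> h j"
    by metis
  have "independent_family I a"
    unfolding independent_family_def
  proof (intro allI impI)
    fix J K
    assume JK: "finite J \<and> finite K \<and> J \<subseteq> I \<and> K \<subseteq> I \<and> J \<inter> K = {}"
    then have "J \<in> h ` {..<2 ^ card I}" using h by auto
    then obtain j where j: "j < 2 ^ card I" "h j = J" by auto
    then have uf: "ultrafilter (y j)" using assms(2) by simp
    then have pf: "proper_filter (y j)" by (simp add: ultrafilter_def)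
    have "inf (finite_meet J a) (finite_meet K (\<lambda>i. - a i)) \<in> y j"
      using JK j a(2)[OF j(1)]
      by (auto simp: proper_filter_inf_iff[OF pf] finite_meet_in_proper_filter_iff[OF pf]
          ultrafilter_compl_iff[OF uf])
    then show "inf (finite_meet J a) (finite_meet K (\<lambda>i. - a i)) \<noteq> bot"
      using pf by (auto simp: proper_filter_def)
  qed
  with a(1) show thesis by (intro that) auto
qed

section \<open>Convergence in the Stone space\<close>

text \<open>
  This says that the indicator sequence of \<open>a\<close> along \<open>x\<close> converges. When the terms are ultrafilters,
  it is convergence of the two-valued homomorphisms \<open>x k\<close> at the point \<open>a\<close>.
\<close>
definition eventually_decides :: "(nat \<Rightarrow> 'b set) \<Rightarrow> 'b \<Rightarrow> bool" where
  "eventually_decides x a \<longleftrightarrow>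
    (\<forall>\<^sub>F k in sequentially. a \<in> x k) \<or> (\<forall>\<^sub>F k in sequentially. a \<notin> x k)"

lemma eventually_decides_subseq:
  assumes "eventually_decides x a" and "strict_mono r"
  shows "eventually_decides (x \<circ> r) a"
  using assms unfolding eventually_decides_def by (auto dest: eventually_subseq)

lemma eventually_decides_shift:
  "eventually_decides (x \<circ> (+) n) a \<longleftrightarrow> eventually_decides x a"
  using eventually_sequentially_seg[of "\<lambda>k. a \<in> x k" n]
    eventually_sequentially_seg[of "\<lambda>k. a \<notin> x k" n]
  by (simp add: eventually_decides_def add.commute)

lemma deciding_subseq_if_no_independent:
  fixes x :: "nat \<Rightarrow> 'a::boolean_algebra set" and I :: "'i set"
  assumes uf: "\<And>k. ultrafilter (x k)" and "finite I"
    and no_indep: "\<not> (\<exists>a :: 'i \<Rightarrow> 'a. a ` I \<subseteq> G \<and> independent_family I a)"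
  obtains r :: "nat \<Rightarrow> nat" where "strict_mono r" and "\<And>a. a \<in> G \<Longrightarrow> eventually_decides (x \<circ> r) a"
proof -
  define C where "C = (\<lambda>a. {k. a \<in> x k}) ` G"
  have "\<exists>S\<subseteq>{..<2 ^ card I}. \<forall>A\<in>C. \<exists>j<2 ^ card I. \<not> (k j \<in> A \<longleftrightarrow> j \<in> S)" for k :: "nat \<Rightarrow> nat"
  proof (rule ccontr)
    assume "\<not> ?thesis"
    then have "\<exists>a\<in>G. \<forall>j<2 ^ card I. a \<in> x (k j) \<longleftrightarrow> j \<in> S" if "S \<subseteq> {..<2 ^ card I}" for S
      using that by (auto simp: C_def)
    then show False
      using independent_family_if_shattered[OF \<open>finite I\<close>, of "x \<circ> k" G] uf no_indep
      by (metis comp_apply)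
  qed
  then obtain M where "infinite M" and M: "\<And>A. A \<in> C \<Longrightarrow> finite (M \<inter> A) \<or> finite (M - A)"
    using infinite_set_splitting_no_member by metis
  define r where "r = enumerate M"
  have r: "strict_mono r" "\<And>k. r k \<in> M"
    using \<open>infinite M\<close> by (auto simp: r_def strict_mono_enumerate enumerate_in_set)
  have avoid: "\<forall>\<^sub>F k in sequentially. r k \<notin> B" if "finite (M \<inter> B)" for B
  proof -
    have "finite (r -` (M \<inter> B))"
      using that r(1) by (intro finite_vimageI strict_mono_imp_inj_on)
    then show ?thesis
      using r(2) by (simp add: cofinite_eq_sequentially[symmetric] eventually_cofinite vimage_def)
  qed
  have "eventually_decides (x \<circ> r) a" if "a \<in> G" for a
  proof -
    have "finite (M \<inter> {k. a \<in> x k}) \<or> finite (M \<inter> {k. a \<notin> x k})"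
      using M[of "{k. a \<in> x k}"] that by (auto simp: C_def Diff_eq Compl_eq)
    then show ?thesis
      using avoid unfolding eventually_decides_def by fastforce
  qed
  with r(1) show thesis by (rule that)
qed

lemma eventually_decides_generated:
  assumes uf: "\<And>k. ultrafilter (x k)"
    and "\<And>a. a \<in> G \<Longrightarrow> eventually_decides x a"
    and "a \<in> generated_subalgebra G"
  shows "eventually_decides x a"
proof -
  have pf: "proper_filter (x k)" for k using uf by (simp add: ultrafilter_def)
  have compl: "eventually_decides x (- a)" if "eventually_decides x a" for a
    using that unfolding eventually_decides_def ultrafilter_compl_iff[OF uf] by auto
  have inf: "eventually_decides x (inf a b)"
    if "eventually_decides x a" "eventually_decides x b" for a b
  proof (cases "(\<forall>\<^sub>F k in sequentially. a \<in> x k) \<and> (\<forall>\<^sub>F k in sequentially. b \<in> x k)")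
    case True
    then show ?thesis
      by (simp add: eventually_decides_def proper_filter_inf_iff[OF pf] eventually_conj)
  next
    case False
    with that have "(\<forall>\<^sub>F k in sequentially. a \<notin> x k) \<or> (\<forall>\<^sub>F k in sequentially. b \<notin> x k)"
      unfolding eventually_decides_def by blast
    then have "\<forall>\<^sub>F k in sequentially. \<not> (a \<in> x k \<and> b \<in> x k)"
      by (auto elim: eventually_mono)
    then show ?thesis
      by (simp add: eventually_decides_def proper_filter_inf_iff[OF pf])
  qed
  have top: "eventually_decides x top"
    using pf by (simp add: eventually_decides_def proper_filter_def)
  show ?thesis
    using assms(3)
  proof induction
    case (sup a b)
    have "sup a b = - inf (- a) (- b)" by simp
    then show ?case using sup.IH compl inf by metis
  next
    case bot
    show ?case using compl[OF top] by simp
  qed (auto intro: assms(2) compl inf top)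
qed

text \<open>
  The Stone topology is that of pointwise convergence of two-valued homomorphisms, so the limit must
  consist of the elements that eventually belong to the terms. Eventual decision makes this filter
  prime.
\<close>
lemma convergent_if_eventually_decides:
  fixes x :: "nat \<Rightarrow> 'a::boolean_algebra set"
  assumes uf: "\<And>k. ultrafilter (x k)" and dec: "\<And>a. eventually_decides x a"
  obtains l where "ultrafilter l" and "limitin (stone_space TYPE('a)) x l sequentially"
proof -
  have pf: "proper_filter (x k)" for k using uf by (simp add: ultrafilter_def)
  define l where "l = {a. \<forall>\<^sub>F k in sequentially. a \<in> x k}"
  have "proper_filter l"
    unfolding proper_filter_def
  proof (intro conjI ballI allI impI)
    show "top \<in> l" "bot \<notin> l" using pf by (auto simp: l_def proper_filter_def)
    show "inf a b \<in> l" if "a \<in> l" "b \<in> l" for a b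
      using that by (simp add: l_def proper_filter_inf_iff[OF pf] eventually_conj)
    show "b \<in> l" if "a \<in> l" "a \<le> b" for a b
      using that pf unfolding l_def proper_filter_def by (auto elim: eventually_mono)
  qed
  moreover have "a \<in> l \<or> - a \<in> l" for a
    using dec[of a] by (simp add: l_def eventually_decides_def ultrafilter_compl_iff[OF uf])
  ultimately have "ultrafilter l" by (simp add: ultrafilter_iff_prime)
  moreover have "limitin (stone_space TYPE('a)) x l sequentially"
    unfolding limitin_def
  proof (intro conjI allI impI)
    show "l \<in> topspace (stone_space TYPE('a))"
      using \<open>ultrafilter l\<close> by (simp add: topspace_stone_space)
    fix U
    assume U: "openin (stone_space TYPE('a)) U \<and> l \<in> U"
    then have "generate_topology_on (range (ult_basic :: 'a \<Rightarrow> _)) U"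
      by (simp add: stone_space_def openin_topology_generated_by_iff)
    then have "l \<in> U \<longrightarrow> (\<forall>\<^sub>F k in sequentially. x k \<in> U)"
    proof induction
      case (Int U V)
      then show ?case by (auto simp: eventually_conj)
    next
      case (UN K)
      show ?case
      proof
        assume "l \<in> \<Union>K"
        then obtain V where "V \<in> K" "l \<in> V" by blast
        with UN.IH have "\<forall>\<^sub>F k in sequentially. x k \<in> V" by blast
        then show "\<forall>\<^sub>F k in sequentially. x k \<in> \<Union>K"
          using \<open>V \<in> K\<close> by (auto elim: eventually_mono)
      qed
    next
      case (Basis U)
      then show ?case using uf by (auto simp: ult_basic_def l_def)
    qed simp
    with U show "\<forall>\<^sub>F k in sequentially. x k \<in> U" by blast
  qed
  ultimately show thesis by (rule that)
qed

theorem theorem9p4: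
  assumes "UWRN TYPE('a::boolean_algebra)"
  shows "seq_compact_space (stone_space TYPE('a))"
  unfolding seq_compact_space_def topspace_stone_space
proof (intro allI impI)
  fix x :: "nat \<Rightarrow> 'a set"
  assume "\<forall>n. x n \<in> {F. ultrafilter F}"
  then have uf: "ultrafilter (x k)" for k by simp
  from assms obtain G :: "nat \<Rightarrow> 'a set"
    where gen: "generated_subalgebra (\<Union>n\<in>{1..}. G n) = UNIV"
      and G: "\<And>n. n \<ge> 1 \<Longrightarrow>
        \<not> (\<exists>a :: nat \<Rightarrow> 'a. a ` {1..n} \<subseteq> G n \<and> independent_family {1..n} a)"
    unfolding UWRN_def by blast
  \<comment> \<open>The pieces \<open>G n\<close> are indexed from \<open>1\<close>, the diagonal construction from \<open>0\<close>.\<close>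
  interpret subseqs "\<lambda>n s. \<forall>a\<in>G (Suc n). eventually_decides (x \<circ> s) a"
  proof
    fix n :: nat and s :: "nat \<Rightarrow> nat"
    obtain r where "strict_mono r" "\<And>a. a \<in> G (Suc n) \<Longrightarrow> eventually_decides ((x \<circ> s) \<circ> r) a"
      using deciding_subseq_if_no_independent[of "x \<circ> s" "{1..Suc n}" "G (Suc n)"] uf G[of "Suc n"]
      by auto
    then show "\<exists>r. strict_mono r \<and> (\<forall>a\<in>G (Suc n). eventually_decides (x \<circ> (s \<circ> r)) a)"
      by (auto simp: comp_assoc)
  qed
  have "eventually_decides (x \<circ> diagseq) a" if "a \<in> G (Suc n)" for a n
  proof -
    have "\<forall>a\<in>G (Suc n). eventually_decides (x \<circ> (diagseq \<circ> (+) (Suc n))) a"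
    proof (rule diagseq_holds)
      fix r s :: "nat \<Rightarrow> nat" and n
      assume "strict_mono r" "\<forall>a\<in>G (Suc n). eventually_decides (x \<circ> s) a"
      then show "\<forall>a\<in>G (Suc n). eventually_decides (x \<circ> (s \<circ> r)) a"
        using eventually_decides_subseq by (metis comp_assoc)
    qed
    then have "eventually_decides ((x \<circ> diagseq) \<circ> (+) (Suc n)) a"
      unfolding comp_assoc using that by blast
    then show ?thesis by (simp only: eventually_decides_shift)
  qed
  then have dec: "eventually_decides (x \<circ> diagseq) a" if "a \<in> (\<Union>n\<in>{1..}. G n)" for a
    using that by (auto dest!: Suc_le_D)
  have "eventually_decides (x \<circ> diagseq) a" for a
  proof (rule eventually_decides_generated)
    show "ultrafilter ((x \<circ> diagseq) k)" for k using uf by simp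
    show "a \<in> generated_subalgebra (\<Union>n\<in>{1..}. G n)" unfolding gen by (rule UNIV_I)
  qed (rule dec)
  then obtain l where "ultrafilter l" "limitin (stone_space TYPE('a)) (x \<circ> diagseq) l sequentially"
    using convergent_if_eventually_decides[of "x \<circ> diagseq"] uf by auto
  then show "\<exists>l\<in>{F. ultrafilter F}. \<exists>r. strict_mono r \<and>
      limitin (stone_space TYPE('a)) (x \<circ> r) l sequentially"
    using subseq_diagseq by blast
qed

end
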